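(* Let $N\ge 1$ and let $A^{(N)}$ be a generator in a stable sandpile $\eta \in \Omega$ that has the form of an $N\times N$ square. Then $$\mathbb{E}[X(\eta)\mid Y \in A^{(N)}] = \frac{3N^4+15N^3+20N^2-8}{30N}.$$
   Context: Fix an integer $L\ge 1$ and let $V=\{1,\ldots,L\}^2\subset\mathbb{Z}^2$. For $v,w\in V$ write $v\sim w$ if $v,w$ are nearest neighbours in $\mathbb{Z}^2$; connectedness of subsets of $V$ refers to this relation. All vertices of $\mathbb{Z}^2\setminus V$ are identified with a single sink; every $v\in V$ has four edges to its lattice neighbours, those leading outside $V$ going to the sink (grains sent there are discarded). A sandpile is a map $\eta:V\to\mathbb{Z}$. $\Omega$ is the set of stable sandpiles, i.e. those with $0\le\eta(v)<4$ for all $v\in V$. A vertex $v$ is critical in $\eta$ if $\eta(v)=3$. A generator in $\eta$ is a connected component (maximal connected set) of the set of critical vertices of $\eta$. Toppling a vertex $v\in V$ decreases $\eta(v)$ by $4$ and increases $\eta(w)$ by $1$ for each $w\in V$ with $w\sim v$; the toppling is legal if $\eta(v)>3$. Avalanche size: for $\eta\in\Omega$ and $v\in V$, $x(\eta,v)$ is the total number of topplings (counted with multiplicity) in any sequence of legal topplings that starts at the configuration obtained from $\eta$ by adding one grain at $v$ and ends at a stable configuration; this number is finite and independent of the sequence. $Y$ is uniformly distributed on $V$ (the vertex where the next grain lands) and $X(\eta)=x(\eta,Y)$, so for nonempty $B\subseteq V$, $\mathbb{E}[X(\eta)\mid Y\in B]=\frac{1}{|B|}\sum_{v\in B}x(\eta,v)$.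 *)

theory Defs
  imports "HOL-Probability.Probability"
begin

type_synonym vertex = "int \<times> int"

text \<open>
  A sandpile on the box of side \<open>L\<close> is an element of \<open>vertices L \<rightarrow>\<^sub>E UNIV\<close>: off the box it has the fixed
  dummy value \<open>undefined\<close>. The sink is not represented, since grains sent there are discarded.
\<close>

type_synonym sandpile = "vertex \<Rightarrow> int"

definition vertices :: "nat \<Rightarrow> vertex set" where
  "vertices L = {1..int L} \<times> {1..int L}"

definition adjacent :: "vertex \<Rightarrow> vertex \<Rightarrow> bool" where
  "adjacent v w \<longleftrightarrow> \<bar>fst v - fst w\<bar> + \<bar>snd v - snd w\<bar> = 1"

definition stable_sandpiles :: "nat \<Rightarrow> sandpile set" where
  "stable_sandpiles L = vertices L \<rightarrow>\<^sub>E {0..<4}"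

definition connected_vertices :: "vertex set \<Rightarrow> bool" where
  "connected_vertices S \<longleftrightarrow>
     (\<forall>v\<in>S. \<forall>w\<in>S. (v, w) \<in> {(a, b). a \<in> S \<and> b \<in> S \<and> adjacent a b}\<^sup>*)"

definition critical :: "nat \<Rightarrow> sandpile \<Rightarrow> vertex set" where
  "critical L \<eta> = {v \<in> vertices L. \<eta> v = 3}"

text \<open>
  \<^term>\<open>connected_vertices {}\<close> holds, so nonemptiness is required explicitly of a component.
\<close>

definition generator :: "nat \<Rightarrow> sandpile \<Rightarrow> vertex set \<Rightarrow> bool" where
  "generator L \<eta> A \<longleftrightarrow>
     A \<noteq> {} \<and> A \<subseteq> critical L \<eta> \<and> connected_vertices A \<and>
     (\<forall>B. A \<subseteq> B \<and> B \<subseteq> critical L \<eta> \<and> connected_vertices B \<longrightarrow> B = A)"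

definition square_shaped :: "nat \<Rightarrow> vertex set \<Rightarrow> bool" where
  "square_shaped N A \<longleftrightarrow> (\<exists>a b. A = {a..<a + int N} \<times> {b..<b + int N})"

definition add_grain :: "vertex \<Rightarrow> sandpile \<Rightarrow> sandpile" where
  "add_grain v \<eta> = \<eta>(v := \<eta> v + 1)"

definition topple :: "nat \<Rightarrow> vertex \<Rightarrow> sandpile \<Rightarrow> sandpile" where
  "topple L v \<eta> = (\<lambda>w. if w = v then \<eta> w - 4
                        else if w \<in> vertices L \<and> adjacent v w then \<eta> w + 1
                        else \<eta> w)"

text \<open>
  \<open>legal_topplings L \<eta> vs \<eta>'\<close>: toppling the vertices of \<open>vs\<close> in order is legal at every step and
  leads from \<open>\<eta>\<close> to \<open>\<eta>'\<close>.
\<close>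

inductive legal_topplings :: "nat \<Rightarrow> sandpile \<Rightarrow> vertex list \<Rightarrow> sandpile \<Rightarrow> bool"
  for L :: nat where
  none: "legal_topplings L \<eta> [] \<eta>"
| step: "legal_topplings L \<eta> (v # vs) \<eta>'"
    if "v \<in> vertices L" "\<eta> v > 3" "legal_topplings L (topple L v \<eta>) vs \<eta>'"

text \<open>
  The description is proper for stable \<open>\<eta>\<close> and \<open>v\<close> in the box: stabilising sequences exist and all
  have the same length.
\<close>

definition avalanche_size :: "nat \<Rightarrow> sandpile \<Rightarrow> vertex \<Rightarrow> nat" where
  "avalanche_size L \<eta> v =
     (THE n. \<exists>vs. \<exists>\<eta>'\<in>stable_sandpiles L.
        legal_topplings L (add_grain v \<eta>) vs \<eta>' \<and> length vs = n)"

text \<open>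
  The conditional expectation of the avalanche size given \<open>Y \<in> B\<close>, for \<open>Y\<close> uniform on the box.
  \<open>B\<close> has to meet the box for \<^const>\<open>cond_pmf\<close> to be meaningful.
\<close>

definition expected_avalanche :: "nat \<Rightarrow> sandpile \<Rightarrow> vertex set \<Rightarrow> real" where
  "expected_avalanche L \<eta> B =
     measure_pmf.expectation (cond_pmf (pmf_of_set (vertices L)) B)
       (\<lambda>v. real (avalanche_size L \<eta> v))"

end

theory Submission
  imports Defs
begin

text \<open>
  The proof computes, for a grain dropped at \<open>v\<close> in the square, how often every vertex topples.

  Call a nonnegative function \<open>c\<close> stabilising if toppling every \<open>x\<close> exactly \<open>c x\<close> times, legally or
  not, leaves no vertex of the box above 3. By the least action principle a legal sequence never
  topples a vertex more often than a stabilising function does (\<open>least_action\<close>). The toppling counts of a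
  sequence that ends in a stable sandpile are themselves stabilising, so they form the least
  stabilising function, and the avalanche size is the sum of that function
  (\<open>avalanche_size_eq_sum\<close>).

  Let \<open>d x\<close> be the depth of \<open>x\<close> in the square: 1 on the outermost layer, 2 on the next one, and
  nonpositive outside. The least stabilising function is \<open>min (d v) (d x)\<close> on the square and 0
  elsewhere; in the language of waves, the \<open>k\<close>-th wave topples the concentric square \<open>d \<ge> k\<close>, and there
  are \<open>d v\<close> waves.
  \<^item> It is stabilising (\<open>odometer_stabilises\<close>) because it is concave along both axes inside the square,
    with strict loss at \<open>v\<close>, which pays for the added grain. A vertex just outside the square gains one
    grain, which it can hold: it is not critical, since the generator is a maximal connected set.
  \<^item> It is least (\<open>level_le_stabilising\<close>) because the vertices of \<open>d \<ge> k\<close> are full: if all of them have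
    toppled \<open>k - 1\<close> times, the extra grain forces \<open>v\<close> to topple once more, and each further toppling
    of a vertex forces its neighbours in \<open>d \<ge> k\<close> to follow.

  Averaging over \<open>v\<close> leads to the double sum of \<open>min (d v) (d x)\<close>. Writing the minimum as the number of
  levels \<open>j\<close> with \<open>j < d v\<close> and \<open>j < d x\<close>, this is the sum over \<open>j\<close> of the squared cardinalities of the
  concentric squares, that is of \<open>(N - 2 j) ^ 4\<close>, which has a closed form.
\<close>

section \<open>The abelian property and least action\<close>

text \<open>
  The configuration after each \<open>x\<close> has toppled \<open>c x\<close> times. No box appears in it: topplings outside the
  box are modelled by \<open>c\<close> being positive there, and a function that vanishes off the box describes
  topplings of box vertices only.
\<close>

definition toppled :: "sandpile \<Rightarrow> (vertex \<Rightarrow> int) \<Rightarrow> sandpile" where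
  "toppled \<eta> c = (\<lambda>(p, q).
     \<eta> (p, q) - 4 * c (p, q) + c (p + 1, q) + c (p - 1, q) + c (p, q + 1) + c (p, q - 1))"

lemma adjacent_iff:
  "adjacent v (p, q) \<longleftrightarrow> v \<in> {(p + 1, q), (p - 1, q), (p, q + 1), (p, q - 1)}"
proof -
  obtain r s where v: "v = (r, s)" by fastforce
  have "\<bar>r - p\<bar> + \<bar>s - q\<bar> = 1 \<longleftrightarrow>
      r = p + 1 \<and> s = q \<or> r = p - 1 \<and> s = q \<or> r = p \<and> s = q + 1 \<or> r = p \<and> s = q - 1"
    by (cases "r \<ge> p"; cases "s \<ge> q") auto
  then show ?thesis by (simp add: adjacent_def v)
qed

text \<open>
  Moving one toppling from the count \<open>c\<close> to the configuration changes nothing; this is what lets the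
  inductions below peel off the first toppling of a sequence.
\<close>

lemma toppled_topple:
  assumes "v \<in> vertices L" "x \<in> vertices L"
  shows "toppled (topple L v \<eta>) (c(v := c v - 1)) x = toppled \<eta> c x"
proof -
  obtain p q where x: "x = (p, q)" by fastforce
  consider "v = (p, q)" | "v = (p + 1, q)" | "v = (p - 1, q)" | "v = (p, q + 1)" | "v = (p, q - 1)"
    | "v \<notin> {(p, q), (p + 1, q), (p - 1, q), (p, q + 1), (p, q - 1)}"
    by blast
  then show ?thesis
    using assms(2) by cases (auto simp: x toppled_def topple_def adjacent_iff)
qed

lemma finite_vertices [simp]: "finite (vertices L)"
  by (simp add: vertices_def)

lemma legal_topplings_set: "legal_topplings L \<eta> vs \<eta>' \<Longrightarrow> set vs \<subseteq> vertices L"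
  by (induction rule: legal_topplings.induct) auto

lemma legal_topplings_result:
  assumes "legal_topplings L \<eta> vs \<eta>'" "x \<in> vertices L"
  shows "\<eta>' x = toppled \<eta> (\<lambda>y. int (count_list vs y)) x"
  using assms
proof (induction rule: legal_topplings.induct)
  case (none \<eta>)
  then show ?case by (simp add: toppled_def split: prod.splits)
next
  case (step v \<eta> vs \<eta>')
  let ?c = "\<lambda>y. int (count_list (v # vs) y)"
  have "(\<lambda>y. int (count_list vs y)) = ?c(v := ?c v - 1)"
    by auto
  then show ?case
    using step toppled_topple[of v L x \<eta> ?c] by simp
qed

text \<open>
  A vertex above 3 only gains from topplings elsewhere, so it can only be brought down by toppling
  itself.
\<close>

lemma positive_at_unstable:
  assumes "\<And>x. 0 \<le> u x" "toppled \<eta> u v \<le> 3" "\<eta> v > 3"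
  shows "u v \<ge> 1"
proof (rule ccontr)
  obtain p q where v: "v = (p, q)" by fastforce
  assume "\<not> u v \<ge> 1"
  then have "u (p, q) = 0" using assms(1)[of v] v by simp
  then show False
    using assms(2,3) assms(1)[of "(p + 1, q)"] assms(1)[of "(p - 1, q)"]
      assms(1)[of "(p, q + 1)"] assms(1)[of "(p, q - 1)"] v
    by (simp add: toppled_def)
qed

text \<open>
  The first legal toppling happens at an unstable vertex, where \<open>u\<close> is positive; after it, \<open>u\<close> lowered by
  one at that vertex is still nonnegative and stabilising.
\<close>

lemma least_action:
  assumes "legal_topplings L \<eta> vs \<eta>'"
    and "\<And>x. 0 \<le> u x" and "\<And>x. x \<in> vertices L \<Longrightarrow> toppled \<eta> u x \<le> 3"
  shows "int (count_list vs x) \<le> u x"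
  using assms
proof (induction arbitrary: u rule: legal_topplings.induct)
  case (none \<eta>)
  then show ?case by simp
next
  case (step v \<eta> vs \<eta>')
  have "u v \<ge> 1"
    using positive_at_unstable[of u \<eta> v] step by auto
  have "int (count_list vs x) \<le> (u(v := u v - 1)) x"
  proof (rule step.IH[rotated])
    show "toppled (topple L v \<eta>) (u(v := u v - 1)) y \<le> 3" if "y \<in> vertices L" for y
      using toppled_topple[OF step.hyps(1) that] step.prems(2)[OF that] by simp
    show "0 \<le> (u(v := u v - 1)) y" for y
      using \<open>u v \<ge> 1\<close> step.prems(1)[of y] by simp
  qed
  then show ?case by (auto split: if_splits)
qed

text \<open>
  The same descent on \<open>u\<close> shows termination: every legal toppling lowers the total of a stabilising
  function by one.
\<close>

lemma ex_legal_stabilisation: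
  assumes "\<eta> \<in> vertices L \<rightarrow>\<^sub>E {0..}"
    and "\<And>x. 0 \<le> u x" and "\<And>x. x \<in> vertices L \<Longrightarrow> toppled \<eta> u x \<le> 3"
  shows "\<exists>vs. \<exists>\<eta>'\<in>stable_sandpiles L. legal_topplings L \<eta> vs \<eta>'"
  using assms
proof (induction "nat (\<Sum>x\<in>vertices L. u x)" arbitrary: \<eta> u rule: less_induct)
  case less
  show ?case
  proof (cases "\<exists>v\<in>vertices L. \<eta> v > 3")
    case False
    then have "\<eta> \<in> stable_sandpiles L"
      using less.prems(1) by (fastforce simp: stable_sandpiles_def PiE_iff)
    then show ?thesis by (blast intro: legal_topplings.none)
  next
    case True
    then obtain v where v: "v \<in> vertices L" "\<eta> v > 3" by blast
    let ?u = "u(v := u v - 1)"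
    have pos: "u v \<ge> 1"
      using positive_at_unstable[of u \<eta> v] less.prems v by auto
    have "(\<Sum>x\<in>vertices L. ?u x) < (\<Sum>x\<in>vertices L. u x)"
      using v by (intro sum_strict_mono_ex1) auto
    moreover have "(\<Sum>x\<in>vertices L. ?u x) \<ge> 0"
      using pos less.prems(2) by (intro sum_nonneg) auto
    ultimately have dec: "nat (\<Sum>x\<in>vertices L. ?u x) < nat (\<Sum>x\<in>vertices L. u x)"
      by linarith
    have "topple L v \<eta> \<in> vertices L \<rightarrow>\<^sub>E {0..}"
      using less.prems(1) v by (auto simp: topple_def PiE_iff extensional_def)
    then have "\<exists>vs. \<exists>\<eta>'\<in>stable_sandpiles L. legal_topplings L (topple L v \<eta>) vs \<eta>'"
    proof (rule less.hyps[OF dec])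
      show "0 \<le> ?u x" for x using pos less.prems(2)[of x] by simp
      show "toppled (topple L v \<eta>) ?u x \<le> 3" if "x \<in> vertices L" for x
        using toppled_topple[OF v(1) that] less.prems(3)[OF that] by simp
    qed
    then show ?thesis
      using v by (blast intro: legal_topplings.step)
  qed
qed

text \<open>
  Least action bounds the counts of a legal stabilisation above by \<open>u\<close>; minimality of \<open>u\<close>, applied to the
  counts themselves, bounds them below. Hence every legal stabilisation has the counts \<open>u\<close>.
\<close>

lemma avalanche_size_eq_sum:
  assumes \<eta>: "\<eta> \<in> stable_sandpiles L" and v: "v \<in> vertices L"
    and u_nonneg: "\<And>x. 0 \<le> u x"
    and u_stab: "\<And>x. x \<in> vertices L \<Longrightarrow> toppled (add_grain v \<eta>) u x \<le> 3"
    and u_min: "\<And>c x. (\<And>x. 0 \<le> c x) \<Longrightarrow>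
        (\<And>x. x \<in> vertices L \<Longrightarrow> toppled (add_grain v \<eta>) c x \<le> 3) \<Longrightarrow> u x \<le> c x"
  shows "int (avalanche_size L \<eta> v) = (\<Sum>x\<in>vertices L. u x)"
proof -
  have len: "int (length vs) = (\<Sum>x\<in>vertices L. u x)"
    if st: "\<eta>' \<in> stable_sandpiles L" and legal: "legal_topplings L (add_grain v \<eta>) vs \<eta>'"
    for vs \<eta>'
  proof -
    have "toppled (add_grain v \<eta>) (\<lambda>y. int (count_list vs y)) x \<le> 3" if "x \<in> vertices L" for x
    proof -
      have "\<eta>' x \<in> {0..<4}" using st that by (auto simp: stable_sandpiles_def)
      then show ?thesis using legal_topplings_result[OF legal that] by simp
    qed
    then have "u x \<le> int (count_list vs x)" for x
      by (intro u_min) auto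
    then have "int (count_list vs x) = u x" for x
      using least_action[OF legal u_nonneg u_stab, of x] by (simp add: order_antisym)
    moreover have "length vs = (\<Sum>x\<in>vertices L. count_list vs x)"
      using sum_count_set[OF legal_topplings_set[OF legal]] by simp
    ultimately show ?thesis by simp
  qed
  have "add_grain v \<eta> \<in> vertices L \<rightarrow>\<^sub>E {0..}"
    using \<eta> v by (auto simp: add_grain_def stable_sandpiles_def PiE_iff extensional_def)
  then obtain vs \<eta>' where ex: "\<eta>' \<in> stable_sandpiles L" "legal_topplings L (add_grain v \<eta>) vs \<eta>'"
    using ex_legal_stabilisation[of "add_grain v \<eta>" L u] u_nonneg u_stab by blast
  have "avalanche_size L \<eta> v = length vs"
    unfolding avalanche_size_def
  proof (rule the_equality)
    show "\<exists>ws. \<exists>\<eta>''\<in>stable_sandpiles L. legal_topplings L (add_grain v \<eta>) ws \<eta>'' \<and> length ws = length vs"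
      using ex by blast
  next
    fix n
    assume "\<exists>ws. \<exists>\<eta>''\<in>stable_sandpiles L. legal_topplings L (add_grain v \<eta>) ws \<eta>'' \<and> length ws = n"
    then show "n = length vs"
      using len ex by (metis of_nat_eq_iff)
  qed
  then show ?thesis using len[OF ex] by simp
qed

section \<open>The odometer of a square generator\<close>

text \<open>
  A critical neighbour of the generator could be added to it without losing connectedness, since the
  new vertex is joined to all others through \<open>y\<close>; this contradicts maximality.
\<close>

lemma generator_boundary_not_critical:
  assumes "generator L \<eta> A" "y \<in> A" "x \<in> vertices L" "x \<notin> A" "adjacent x y"
  shows "\<eta> x \<noteq> 3"
proof
  assume crit: "\<eta> x = 3"
  let ?B = "insert x A"
  let ?R = "{(a, b). a \<in> ?B \<and> b \<in> ?B \<and> adjacent a b}"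
  have sub: "{(a, b). a \<in> A \<and> b \<in> A \<and> adjacent a b}\<^sup>* \<subseteq> ?R\<^sup>*"
    by (rule rtrancl_mono) auto
  have inA: "(a, b) \<in> ?R\<^sup>*" if "a \<in> A" "b \<in> A" for a b
    using that assms(1) sub unfolding generator_def connected_vertices_def by blast
  have xy: "(x, y) \<in> ?R" "(y, x) \<in> ?R"
    using assms by (auto simp: adjacent_def)
  have "(a, b) \<in> ?R\<^sup>*" if "a \<in> ?B" "b \<in> ?B" for a b
  proof -
    have "(a, y) \<in> ?R\<^sup>*"
      using that(1) inA[OF _ assms(2)] xy(1) by (cases "a = x") (blast+)
    moreover have "(y, b) \<in> ?R\<^sup>*"
      using that(2) inA[OF assms(2)] xy(2) by (cases "b = x") (blast+)
    ultimately show ?thesis by (rule rtrancl_trans)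
  qed
  then have "connected_vertices ?B" by (simp add: connected_vertices_def)
  moreover have "?B \<subseteq> critical L \<eta>"
    using assms crit by (auto simp: generator_def critical_def)
  ultimately have "?B = A"
    using assms(1) unfolding generator_def by blast
  then show False using assms(4) by blast
qed

text \<open>
  Inside the square with lower left corner \<open>(a, b)\<close> this is the \<open>\<ell>\<^sub>\<infinity>\<close> distance to the complement.
  Outside it is not truncated at 0, so that it stays a minimum of four affine functions.
\<close>

definition depth :: "int \<Rightarrow> int \<Rightarrow> nat \<Rightarrow> vertex \<Rightarrow> int" where
  "depth a b N = (\<lambda>(p, q). min (min (p - a + 1) (a + int N - p)) (min (q - b + 1) (b + int N - q)))"

lemma depth_ge_iff:
  "j \<le> depth a b N (p, q) \<longleftrightarrow>
     p \<ge> a + j - 1 \<and> p \<le> a + int N - j \<and> q \<ge> b + j - 1 \<and> q \<le> b + int N - j"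
  by (auto simp: depth_def)

lemma depth_superlevel:
  "{x. depth a b N x \<ge> j} = {a + j - 1..a + int N - j} \<times> {b + j - 1..b + int N - j}"
  by (auto simp: depth_ge_iff)

text \<open>The toppling counts of the avalanche started at \<open>v\<close>: a pyramid cut off at the height of \<open>v\<close>.\<close>

definition odometer :: "int \<Rightarrow> int \<Rightarrow> nat \<Rightarrow> vertex \<Rightarrow> vertex \<Rightarrow> int" where
  "odometer a b N v x = max 0 (min (depth a b N v) (depth a b N x))"

lemma depth_attained:
  "depth a b N (p, q) = p - a + 1 \<or> depth a b N (p, q) = a + int N - p \<or>
   depth a b N (p, q) = q - b + 1 \<or> depth a b N (p, q) = b + int N - q"
  by (simp add: depth_def min_def)

lemma depth_le_sides:
  "depth a b N (p, q) \<le> p - a + 1" "depth a b N (p, q) \<le> a + int N - p"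
  "depth a b N (p, q) \<le> q - b + 1" "depth a b N (p, q) \<le> b + int N - q"
  using depth_ge_iff[of "depth a b N (p, q)" a b N p q] by auto

lemma odometer_eq_0: "\<not> depth a b N x \<ge> 1 \<Longrightarrow> odometer a b N v x = 0"
  by (simp add: odometer_def)

lemma odometer_le_sides:
  assumes "depth a b N (p, q) \<ge> 0" "depth a b N v \<ge> 0"
  shows "odometer a b N v (p, q) \<le> p - a + 1" "odometer a b N v (p, q) \<le> a + int N - p"
    "odometer a b N v (p, q) \<le> q - b + 1" "odometer a b N v (p, q) \<le> b + int N - q"
    "odometer a b N v (p, q) \<le> depth a b N v"
  using assms depth_le_sides[of a b N p q] unfolding odometer_def by linarith+

text \<open>
  A vertex of the square and its neighbours have nonnegative depth, and there the odometer is the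
  minimum of a constant and four affine functions. The one that attains the minimum at \<open>(p, q)\<close>
  bounds the odometer at the neighbours.
\<close>

lemma odometer_concave:
  assumes "depth a b N (p, q) \<ge> 1" "depth a b N v \<ge> 0"
  shows "odometer a b N v (p + 1, q) + odometer a b N v (p - 1, q) \<le> 2 * odometer a b N v (p, q)"
    and "odometer a b N v (p, q + 1) + odometer a b N v (p, q - 1) \<le> 2 * odometer a b N v (p, q)"
proof -
  let ?m = "depth a b N v" and ?u = "odometer a b N v"
  have nb: "depth a b N (p + 1, q) \<ge> 0" "depth a b N (p - 1, q) \<ge> 0"
    "depth a b N (p, q + 1) \<ge> 0" "depth a b N (p, q - 1) \<ge> 0"
    using assms(1) by (simp_all add: depth_ge_iff)
  note le = nb[THEN odometer_le_sides(1), OF assms(2)] nb[THEN odometer_le_sides(2), OF assms(2)]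
    nb[THEN odometer_le_sides(3), OF assms(2)] nb[THEN odometer_le_sides(4), OF assms(2)]
    nb[THEN odometer_le_sides(5), OF assms(2)]
  have "?u (p, q) = min ?m (depth a b N (p, q))"
    using assms by (simp add: odometer_def)
  then consider "?u (p, q) = ?m" | "?u (p, q) = p - a + 1" | "?u (p, q) = a + int N - p"
    | "?u (p, q) = q - b + 1" | "?u (p, q) = b + int N - q"
    using depth_attained[of a b N p q] by (auto simp: min_def split: if_splits)
  then show "?u (p + 1, q) + ?u (p - 1, q) \<le> 2 * ?u (p, q)"
    and "?u (p, q + 1) + ?u (p, q - 1) \<le> 2 * ?u (p, q)"
    using le by (cases; linarith)+
qed

text \<open>
  The cases are: the source, another vertex of the square, a vertex outside with a neighbour in the
  square, and a vertex away from the square. In the third case there is exactly one such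
  neighbour, because the square is convex, and it lies on the outermost layer and topples once.
\<close>

lemma odometer_stabilises:
  assumes \<eta>: "\<eta> \<in> stable_sandpiles L" and gen: "generator L \<eta> {x. depth a b N x \<ge> 1}"
    and v: "depth a b N v \<ge> 1" and x: "x \<in> vertices L"
  shows "toppled (add_grain v \<eta>) (odometer a b N v) x \<le> 3"
proof -
  let ?d = "depth a b N" and ?u = "odometer a b N v"
  obtain p q where pq: "x = (p, q)" by fastforce
  let ?nb = "{(p + 1, q), (p - 1, q), (p, q + 1), (p, q - 1)}"
  have le3: "\<eta> x \<le> 3"
    using \<eta> x by (force simp: stable_sandpiles_def)
  consider (src) "x = v" | (ins) "x \<noteq> v" "?d x \<ge> 1"
    | (rim) y where "\<not> ?d x \<ge> 1" "y \<in> ?nb" "?d y \<ge> 1"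
    | (off) "\<not> ?d x \<ge> 1" "\<And>y. y \<in> ?nb \<Longrightarrow> \<not> ?d y \<ge> 1"
    using v by blast
  then show ?thesis
  proof cases
    case src
    have "?u y \<le> ?d v" for y using v by (simp add: odometer_def)
    note le = this[of "(p + 1, q)"] this[of "(p - 1, q)"] this[of "(p, q + 1)"] this[of "(p, q - 1)"]
    \<comment> \<open>One step from the source towards the nearest side leads below the top of the pyramid.\<close>
    have below: "?d (p - 1, q) \<le> ?d v - 1 \<or> ?d (p + 1, q) \<le> ?d v - 1 \<or> ?d (p, q - 1) \<le> ?d v - 1
       \<or> ?d (p, q + 1) \<le> ?d v - 1"
      using depth_attained[of a b N p q] depth_le_sides(1)[of a b N "p - 1" q]
        depth_le_sides(2)[of a b N "p + 1" q] depth_le_sides(3)[of a b N p "q - 1"]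
        depth_le_sides(4)[of a b N p "q + 1"]
      unfolding src[symmetric] pq by linarith
    have "?u (p + 1, q) + ?u (p - 1, q) + ?u (p, q + 1) + ?u (p, q - 1) \<le> 4 * ?d v - 1"
    proof -
      have step: "?u y \<le> ?d v - 1" if "?d y \<le> ?d v - 1" for y
        using that v by (simp add: odometer_def)
      show ?thesis
        using below le by (elim disjE) (drule step, linarith)+
    qed
    moreover have "?u v = ?d v" using v by (simp add: odometer_def)
    ultimately show ?thesis
      using le3 pq src by (simp add: toppled_def add_grain_def)
  next
    case ins
    then show ?thesis
      using le3 pq v odometer_concave[of a b N p q v] by (simp add: toppled_def add_grain_def)
  next
    case rim
    have "adjacent x y" using rim(2) pq by (auto simp: adjacent_def)
    then have "\<eta> x \<noteq> 3"
      using generator_boundary_not_critical[OF gen, of y x] rim x by auto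
    moreover have "?u x = 0" using rim by (simp add: odometer_def)
    moreover have "?u (p + 1, q) + ?u (p - 1, q) + ?u (p, q + 1) + ?u (p, q - 1) \<le> 1"
    proof -
      \<comment> \<open>Two neighbours of \<open>x\<close> in the square would put \<open>x\<close> into it: two on one line have \<open>x\<close> between
        them, and two on different lines share one coordinate each with \<open>x\<close>.\<close>
      let ?P = "{a..a + int N - 1}" and ?Q = "{b..b + int N - 1}"
      have square: "?d (p', q') \<ge> 1 \<longleftrightarrow> p' \<in> ?P \<and> q' \<in> ?Q" for p' q'
        by (auto simp: depth_ge_iff)
      have "p + 1 \<in> ?P \<Longrightarrow> p - 1 \<in> ?P \<Longrightarrow> p \<in> ?P" "q + 1 \<in> ?Q \<Longrightarrow> q - 1 \<in> ?Q \<Longrightarrow> q \<in> ?Q"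
        by simp_all
      then have outside: "\<not> ?d z \<ge> 1" if "z \<in> ?nb" "z \<noteq> y" for z
        using rim that unfolding pq by (elim insertE emptyE; hypsubst; unfold square; blast)
      have zero: "?u z = 0" if "z \<in> ?nb" "z \<noteq> y" for z
        using outside[OF that] by (rule odometer_eq_0)
      have "?d x \<ge> 1" if "?d y \<ge> 2"
        using that rim(2) unfolding pq by (elim insertE emptyE) (simp_all add: depth_ge_iff)
      then have "?u y \<le> 1" using rim(1) by (force simp: odometer_def)
      then show ?thesis
        using rim(2) zero[of "(p + 1, q)"] zero[of "(p - 1, q)"] zero[of "(p, q + 1)"]
          zero[of "(p, q - 1)"]
        by (elim insertE emptyE) simp_all
    qed
    moreover have "x \<noteq> v" using rim v by auto
    ultimately show ?thesis
      using le3 pq by (simp add: toppled_def add_grain_def)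
  next
    case off
    have "?u x = 0" by (rule odometer_eq_0[OF off(1)])
    moreover have "?u y = 0" if "y \<in> ?nb" for y
      by (rule odometer_eq_0[OF off(2)[OF that]])
    moreover have "x \<noteq> v" using off(1) v by auto
    ultimately show ?thesis
      using le3 pq by (simp add: toppled_def add_grain_def)
  qed
qed

text \<open>
  The outer induction is on the level \<open>k\<close>, the inner one on the distance from \<open>x\<close> to the source \<open>v\<close>.
  If \<open>x\<close>, at depth above \<open>k\<close>, toppled only \<open>k\<close> times, then it would have lost \<open>4 k\<close> grains and received
  at least \<open>k\<close> from each neighbour, as all neighbours have depth at least \<open>k\<close>. So it would still hold its
  3 grains, and one more: the added grain if \<open>x = v\<close>, and otherwise the extra grain from a
  neighbour closer to \<open>v\<close>, which toppled more than \<open>k\<close> times.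
\<close>

lemma level_le_stabilising:
  assumes crit: "\<And>x. depth a b N x \<ge> 1 \<Longrightarrow> \<eta> x = 3"
    and nonneg: "\<And>x. 0 \<le> c x"
    and stab: "\<And>x. depth a b N x \<ge> 1 \<Longrightarrow> toppled (add_grain v \<eta>) c x \<le> 3"
    and "int k \<le> depth a b N v" "int k \<le> depth a b N x"
  shows "int k \<le> c x"
  using assms(4,5)
proof (induction k arbitrary: x)
  case 0
  then show ?case using nonneg by simp
next
  case (Suc k)
  let ?d = "depth a b N"
  obtain r s where v: "v = (r, s)" by fastforce
  have level: "int k \<le> c y" if "?d y \<ge> int k" for y
    using Suc that by simp
  from Suc.prems(2) show ?case
  proof (induction "nat (\<bar>fst x - r\<bar> + \<bar>snd x - s\<bar>)" arbitrary: x rule: less_induct)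
    case less
    obtain p q where x: "x = (p, q)" by fastforce
    let ?nb = "{(p + 1, q), (p - 1, q), (p, q + 1), (p, q - 1)}"
    have dx: "?d x \<ge> 1" using less.prems by simp
    have nb: "int k \<le> c y" if "y \<in> ?nb" for y
      using that less.prems x by (intro level) (auto simp: depth_ge_iff)
    note nb4 = nb[of "(p + 1, q)"] nb[of "(p - 1, q)"] nb[of "(p, q + 1)"] nb[of "(p, q - 1)"]
    have "int k \<le> c x" using less.prems by (intro level) simp
    show ?case
    proof (rule ccontr)
      assume "\<not> int (Suc k) \<le> c x"
      then have cx: "c (p, q) = int k" using \<open>int k \<le> c x\<close> x by simp
      show False
      proof (cases "x = v")
        case True
        then show False
          using stab[OF dx] crit[OF dx] cx nb4 unfolding x True[symmetric]
          by (simp add: toppled_def add_grain_def)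
      next
        case False
        \<comment> \<open>The neighbour one step closer to the source. It stays at depth above \<open>k\<close> because \<open>x\<close>
          and the source do.\<close>
        define y where "y = (if p < r then (p + 1, q) else if p > r then (p - 1, q)
           else if q < s then (p, q + 1) else (p, q - 1))"
        have "nat (\<bar>fst y - r\<bar> + \<bar>snd y - s\<bar>) < nat (\<bar>fst x - r\<bar> + \<bar>snd x - s\<bar>)"
          using False x v by (auto simp: y_def)
        moreover have "?d y \<ge> int (Suc k)"
          using False x v less.prems Suc.prems(1) by (auto simp: y_def depth_ge_iff)
        ultimately have "int (Suc k) \<le> c y" by (rule less.hyps)
        moreover have "y \<in> ?nb" by (auto simp: y_def)
        ultimately show False
          using False stab[OF dx] crit[OF dx] cx nb4 x by (auto simp: toppled_def add_grain_def)
      qed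
    qed
  qed
qed

lemma odometer_minimal:
  assumes crit: "\<And>x. depth a b N x \<ge> 1 \<Longrightarrow> \<eta> x = 3"
    and nonneg: "\<And>x. 0 \<le> c x"
    and stab: "\<And>x. depth a b N x \<ge> 1 \<Longrightarrow> toppled (add_grain v \<eta>) c x \<le> 3"
  shows "odometer a b N v x \<le> c x"
proof (cases "odometer a b N v x = 0")
  case True
  then show ?thesis using nonneg by simp
next
  case False
  then have "int (nat (odometer a b N v x)) \<le> c x"
    by (intro level_le_stabilising[OF assms]) (auto simp: odometer_def)
  then show ?thesis by linarith
qed

lemma avalanche_size_square:
  assumes \<eta>: "\<eta> \<in> stable_sandpiles L" and gen: "generator L \<eta> {x. depth a b N x \<ge> 1}"
    and v: "depth a b N v \<ge> 1"
  shows "int (avalanche_size L \<eta> v) =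
    (\<Sum>x\<in>{x. depth a b N x \<ge> 1}. min (depth a b N v) (depth a b N x))"
proof -
  let ?A = "{x. depth a b N x \<ge> 1}"
  have A: "?A \<subseteq> vertices L" and crit: "\<And>x. x \<in> ?A \<Longrightarrow> \<eta> x = 3"
    using gen by (auto simp: generator_def critical_def)
  have "int (avalanche_size L \<eta> v) = (\<Sum>x\<in>vertices L. odometer a b N v x)"
  proof (rule avalanche_size_eq_sum[OF \<eta>])
    show "v \<in> vertices L" using A v by blast
    show "0 \<le> odometer a b N v x" for x by (simp add: odometer_def)
    show "toppled (add_grain v \<eta>) (odometer a b N v) x \<le> 3" if "x \<in> vertices L" for x
      using odometer_stabilises[OF \<eta> gen v that] .
    show "odometer a b N v x \<le> c x"
      if "\<And>x. 0 \<le> c x" "\<And>x. x \<in> vertices L \<Longrightarrow> toppled (add_grain v \<eta>) c x \<le> 3" for c x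
    proof (rule odometer_minimal)
      show "\<eta> y = 3" if "depth a b N y \<ge> 1" for y using crit that by simp
      show "0 \<le> c y" for y by fact
      show "toppled (add_grain v \<eta>) c y \<le> 3" if "depth a b N y \<ge> 1" for y
        using that A \<open>\<And>x. x \<in> vertices L \<Longrightarrow> toppled (add_grain v \<eta>) c x \<le> 3\<close> by blast
    qed
  qed
  also have "\<dots> = (\<Sum>x\<in>?A. odometer a b N v x)"
    using A by (intro sum.mono_neutral_right) (auto simp: odometer_def)
  also have "\<dots> = (\<Sum>x\<in>?A. min (depth a b N v) (depth a b N x))"
    using v by (intro sum.cong) (auto simp: odometer_def)
  finally show ?thesis .
qed

section \<open>Averaging over the square\<close>

text \<open>
  Layer-cake formula: the minimum counts the levels below both values, and for a fixed level the
  sum over pairs factorises.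
\<close>

lemma double_sum_min:
  fixes f :: "'a \<Rightarrow> int"
  assumes "finite A" "\<And>x. x \<in> A \<Longrightarrow> 1 \<le> f x \<and> f x \<le> int n"
  shows "(\<Sum>v\<in>A. \<Sum>x\<in>A. min (f v) (f x)) = (\<Sum>j<n. int (card {x\<in>A. f x > int j}) ^ 2)"
proof -
  have layer: "min (f v) (f x) = (\<Sum>j<n. of_bool (f v > int j) * of_bool (f x > int j))"
    if "v \<in> A" "x \<in> A" for v x
  proof -
    have "(\<Sum>j<n. of_bool (f v > int j) * of_bool (f x > int j))
        = (\<Sum>j<n. of_bool (j < nat (min (f v) (f x))) :: int)"
      by (intro sum.cong) auto
    also have "\<dots> = int (card ({..<n} \<inter> {..<nat (min (f v) (f x))}))"
      by (simp add: lessThan_def)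
    also have "{..<n} \<inter> {..<nat (min (f v) (f x))} = {..<nat (min (f v) (f x))}"
      using assms(2)[OF that(1)] by auto
    finally show ?thesis
      using assms(2)[OF that(1)] assms(2)[OF that(2)] by simp
  qed
  have "(\<Sum>v\<in>A. \<Sum>x\<in>A. min (f v) (f x))
      = (\<Sum>v\<in>A. \<Sum>x\<in>A. \<Sum>j<n. of_bool (f v > int j) * of_bool (f x > int j))"
    by (intro sum.cong refl layer)
  also have "\<dots> = (\<Sum>v\<in>A. \<Sum>j<n. \<Sum>x\<in>A. of_bool (f v > int j) * of_bool (f x > int j))"
    by (intro sum.cong refl sum.swap)
  also have "\<dots> = (\<Sum>j<n. \<Sum>v\<in>A. \<Sum>x\<in>A. of_bool (f v > int j) * of_bool (f x > int j))"
    by (rule sum.swap)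
  also have "\<dots> = (\<Sum>j<n. (\<Sum>v\<in>A. of_bool (f v > int j)) * (\<Sum>x\<in>A. of_bool (f x > int j)))"
    by (simp only: sum_product)
  also have "\<dots> = (\<Sum>j<n. int (card {x\<in>A. f x > int j}) ^ 2)"
    using assms(1) by (simp add: power2_eq_square Collect_conj_eq)
  finally show ?thesis .
qed

text \<open>
  The subtraction is truncated, so the terms with \<open>2 j \<ge> N\<close> vanish and the sum runs over
  \<open>N\<close>, \<open>N - 2\<close>, \<open>N - 4\<close> and so on; the induction goes in steps of two.
\<close>

lemma sum_fourth_powers_step_two:
  "30 * (\<Sum>j<N. real (N - 2 * j) ^ 4) =
     real N * (3 * real N ^ 4 + 15 * real N ^ 3 + 20 * real N ^ 2 - 8)"
proof (induction N rule: induct_nat_012)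
  case 0
  show ?case by simp
next
  case 1
  show ?case by simp
next
  case (ge2 N)
  have "(\<Sum>j<Suc (Suc N). real (Suc (Suc N) - 2 * j) ^ 4)
      = real (N + 2) ^ 4 + (\<Sum>j<Suc N. real (N - 2 * j) ^ 4)"
    by (subst sum.lessThan_Suc_shift) simp
  also have "(\<Sum>j<Suc N. real (N - 2 * j) ^ 4) = (\<Sum>j<N. real (N - 2 * j) ^ 4)"
    by simp
  finally show ?case
    using ge2.IH(1) by (simp add: algebra_simps power4_eq_xxxx power3_eq_cube power2_eq_square)
qed

theorem theorem4p1:
  fixes L N :: nat and \<eta> :: sandpile and A :: "vertex set"
  assumes "L \<ge> 1" and "N \<ge> 1"
    and "\<eta> \<in> stable_sandpiles L"
    and "generator L \<eta> A"
    and "square_shaped N A"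
  shows "expected_avalanche L \<eta> A =
    (3 * real N ^ 4 + 15 * real N ^ 3 + 20 * real N ^ 2 - 8) / (30 * real N)"
proof -
  obtain a b where "A = {a..<a + int N} \<times> {b..<b + int N}"
    using assms(5) by (auto simp: square_shaped_def)
  then have A: "A = {x. depth a b N x \<ge> 1}"
    by (auto simp: depth_superlevel)
  let ?d = "depth a b N"
  have AV: "A \<subseteq> vertices L" and ne: "A \<noteq> {}"
    using assms(4) by (auto simp: generator_def critical_def)
  have fin: "finite A" using AV finite_subset by fastforce
  have card: "card {x \<in> A. ?d x > int j} = (N - 2 * j) ^ 2" for j
  proof -
    have "{x \<in> A. ?d x > int j} = {x. ?d x \<ge> int j + 1}" by (auto simp: A)
    also have "\<dots> = {a + int j..a + int N - int j - 1} \<times> {b + int j..b + int N - int j - 1}"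
      by (simp add: depth_superlevel algebra_simps)
    also have "card \<dots> = nat (int N - 2 * int j) ^ 2"
      by (simp add: card_cartesian_product power2_eq_square algebra_simps)
    also have "nat (int N - 2 * int j) = N - 2 * j" by linarith
    finally show ?thesis .
  qed
  have cardA: "card A = N ^ 2"
  proof -
    have "{x \<in> A. ?d x > int 0} = A" by (auto simp: A)
    then show ?thesis using card[of 0] by simp
  qed
  have "int (\<Sum>v\<in>A. avalanche_size L \<eta> v) = (\<Sum>v\<in>A. \<Sum>x\<in>A. min (?d v) (?d x))"
    using avalanche_size_square[OF assms(3), of a b N] assms(4) by (simp add: A)
  also have "\<dots> = (\<Sum>j<N. int (card {x\<in>A. ?d x > int j}) ^ 2)"
    using fin by (rule double_sum_min) (auto simp: A depth_def)
  also have "\<dots> = int (\<Sum>j<N. (N - 2 * j) ^ 4)"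
    by (simp add: card flip: power_mult)
  finally have "(\<Sum>v\<in>A. avalanche_size L \<eta> v) = (\<Sum>j<N. (N - 2 * j) ^ 4)"
    by (simp only: of_nat_eq_iff)
  then have total: "(\<Sum>v\<in>A. real (avalanche_size L \<eta> v)) = (\<Sum>j<N. real (N - 2 * j) ^ 4)"
    by (simp flip: of_nat_sum of_nat_power)
  have "cond_pmf (pmf_of_set (vertices L)) A = pmf_of_set A"
  proof (rule pmf_eqI)
    have V: "vertices L \<noteq> {}" "vertices L \<inter> A = A" using AV ne by auto
    then have "set_pmf (pmf_of_set (vertices L)) \<inter> A \<noteq> {}" using ne by simp
    then show "pmf (cond_pmf (pmf_of_set (vertices L)) A) x = pmf (pmf_of_set A) x" for x
      using V AV ne fin by (auto simp: pmf_cond measure_pmf_of_set)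
  qed
  then have "expected_avalanche L \<eta> A = (\<Sum>v\<in>A. real (avalanche_size L \<eta> v)) / real (card A)"
    using fin ne by (simp add: expected_avalanche_def integral_pmf_of_set)
  also have "\<dots> = (\<Sum>j<N. real (N - 2 * j) ^ 4) / real N ^ 2"
    by (simp add: total cardA)
  also have "(\<Sum>j<N. real (N - 2 * j) ^ 4)
      = real N * (3 * real N ^ 4 + 15 * real N ^ 3 + 20 * real N ^ 2 - 8) / 30"
    using sum_fourth_powers_step_two[of N] by simp
  also have "\<dots> / real N ^ 2 = (3 * real N ^ 4 + 15 * real N ^ 3 + 20 * real N ^ 2 - 8) / (30 * real N)"
    using assms(2) by (simp add: power2_eq_square)
  finally show ?thesis .
qed

end
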